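(* Let $N \ge d \ge 1$ be integers, let $k>0$, let $\boldsymbol{k}_1,\ldots,\boldsymbol{k}_N \in \mathbb{R}^d$ be wavevectors of the same length $k$, and let $\mathsf{K} = [\boldsymbol{k}_1,\ldots,\boldsymbol{k}_N] \in \mathbb{R}^{d\times N}$. Let $\boldsymbol{u} = [\alpha_1,\ldots,\alpha_N,\beta_1,\ldots,\beta_N]^T \in \mathbb{C}^{2N}$ and, for $\boldsymbol{y}\in\mathbb{R}^N$ and $\boldsymbol{x}\in\mathbb{R}^d$, define $$p_N(\boldsymbol{y};\boldsymbol{u}) = \sum_{j=1}^N \alpha_j \exp[i\boldsymbol{e}_j\cdot\boldsymbol{y}] + \beta_j\exp[-i\boldsymbol{e}_j\cdot\boldsymbol{y}], \qquad p_d(\boldsymbol{x};\boldsymbol{u}) = \sum_{j=1}^N \alpha_j \exp[i\boldsymbol{k}_j\cdot\boldsymbol{x}] + \beta_j\exp[-i\boldsymbol{k}_j\cdot\boldsymbol{x}] = p_N(\mathsf{K}^T\boldsymbol{x};\boldsymbol{u}),$$ where $\boldsymbol{e}_1,\ldots,\boldsymbol{e}_N$ is the canonical basis of $\mathbb{R}^N$. Assume that $\mathrm{rank}(\mathsf{K}) = d$ and that $p_N(\boldsymbol{y};\boldsymbol{u})$ is periodic with primitive cell $[0,2\pi]^N$. Then the function $p_d(\boldsymbol{x};\boldsymbol{u}) = p_N(\mathsf{K}^T\boldsymbol{x};\boldsymbol{u})$ is quasiperiodic if and only if $$\dim\left(\mathrm{range}(\mathsf{K}^T)\cap (2\pi)\mathbb{Z}^N\right)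 \le d-1.$$
   Context: The dimension of a set of vectors is defined as the dimension of its linear span, and $(2\pi)\mathbb{Z}^N = \{2\pi\boldsymbol{n} : \boldsymbol{n}\in\mathbb{Z}^N\}$. A function on $\mathbb{R}^d$ is periodic if it has $d$ linearly independent period vectors $\boldsymbol{a}_1,\ldots,\boldsymbol{a}_d\in\mathbb{R}^d$ (it is invariant under translation by $n_1\boldsymbol{a}_1+\cdots+n_d\boldsymbol{a}_d$ for all integers $n_1,\ldots,n_d$). A function $f$ on $\mathbb{R}^d$ is quasiperiodic if it is not periodic and yet there are a periodic function $g$ on $\mathbb{R}^N$ with $N>d$ and a matrix $\mathsf{K}\in\mathbb{R}^{d\times N}$ such that $f(\boldsymbol{x}) = g(\mathsf{K}^T\boldsymbol{x})$; in particular a quasiperiodic function is periodic along at most $d-1$ linearly independent directions. "$p_N$ is periodic with primitive cell $[0,2\pi]^N$" means that the period vectors of $p_N(\cdot;\boldsymbol{u})$ are exactly the vectors of the lattice $(2\pi)\mathbb{Z}^N$.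
   Formalization: Added assumption: for every j, the part of p_d made of the waves with wavevectors ±k_j is not identically zero (automatic if the vectors ±k_1,…,±k_N are distinct); without it, repeated wavevectors with cancelling amplitudes give counterexamples. *)

theory Defs
  imports "HOL-Analysis.Analysis" "HOL-Library.Function_Algebras"
begin

section \<open>The spaces \<open>\<real>\<^sup>N\<close> with \<open>N\<close> a bound variable\<close>

text \<open>
  The fixed dimensions of the result are type indices: \<open>\<real>\<^sup>d\<close> is \<^typ>\<open>real^'d\<close>. The definition of
  quasiperiodicity, however, contains an existential quantifier over the dimension \<open>N\<close>, which cannot
  range over types. There \<open>\<real>\<^sup>N\<close> is the subspace of \<^typ>\<open>nat \<Rightarrow> real\<close> (with pointwise operations)
  consisting of the sequences that vanish from index \<open>N\<close> on.
\<close>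

instantiation "fun" :: (type, real_vector) real_vector
begin

definition scaleR_fun :: "real \<Rightarrow> ('a \<Rightarrow> 'b) \<Rightarrow> 'a \<Rightarrow> 'b"
  where "scaleR_fun c f = (\<lambda>x. c *\<^sub>R f x)"

instance
  by standard (auto simp: scaleR_fun_def fun_eq_iff plus_fun_def scaleR_add_right scaleR_add_left)

end

definition coord_space :: "nat \<Rightarrow> (nat \<Rightarrow> real) set"
  where "coord_space N = {y. \<forall>j\<ge>N. y j = 0}"

lemma sum_fun_apply: "(\<Sum>i\<in>A. F i) x = (\<Sum>i\<in>A. F i x)"
  for F :: "'i \<Rightarrow> 'a \<Rightarrow> 'b::comm_monoid_add"
  by (induction A rule: infinite_finite_induct) (auto simp: zero_fun_def plus_fun_def)

lemma subspace_coord_space: "subspace (coord_space N)"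
  by (auto simp: subspace_def coord_space_def zero_fun_def plus_fun_def scaleR_fun_def)

lemma dim_coord_space: "dim (coord_space N) = N"
proof -
  define b :: "nat \<Rightarrow> nat \<Rightarrow> real" where "b j = (\<lambda>i. if i = j then 1 else 0)" for j
  have inj: "inj_on b A" for A
    by (rule inj_onI) (metis b_def zero_neq_one)
  have expand: "(\<Sum>j<N. c j *\<^sub>R b j) i = (if i < N then c i else 0)" for c i
    by (simp add: sum_fun_apply scaleR_fun_def b_def if_distrib cong: if_cong)
  have "independent (b ` {..<N})"
  proof (rule independent_if_scalars_zero)
    fix u and v assume s: "(\<Sum>x\<in>b ` {..<N}. u x *\<^sub>R x) = 0" and "v \<in> b ` {..<N}"
    then obtain i where i: "i < N" "v = b i" by auto
    have "(\<Sum>j<N. u (b j) *\<^sub>R b j) = 0"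
      using s by (simp add: sum.reindex[OF inj])
    from fun_cong[OF this, of i] show "u v = 0"
      using i expand[of "\<lambda>j. u (b j)" i] by simp
  qed simp
  moreover have "coord_space N \<subseteq> span (b ` {..<N})"
  proof
    fix y assume "y \<in> coord_space N"
    then have "y = (\<Sum>j<N. y j *\<^sub>R b j)"
      by (auto simp: fun_eq_iff expand coord_space_def)
    also have "\<dots> \<in> span (b ` {..<N})"
      by (intro span_sum span_scale span_base) auto
    finally show "y \<in> span (b ` {..<N})" .
  qed
  moreover have "b ` {..<N} \<subseteq> coord_space N"
    by (auto simp: coord_space_def b_def)
  ultimately show ?thesis
    using basis_card_eq_dim[of "b ` {..<N}" "coord_space N"] card_image[OF inj, of "{..<N}"] by simp
qed


section \<open>Periodic and quasiperiodic functions\<close>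

definition periods_on :: "'a::real_vector set \<Rightarrow> ('a \<Rightarrow> 'b) \<Rightarrow> 'a set"
  where "periods_on V f = {a \<in> V. \<forall>x\<in>V. f (x + a) = f x}"

text \<open>
  \<open>V\<close> is meant to be a finite-dimensional subspace. Integer combinations of periods are again periods,
  so invariance under the individual \<open>a\<^sub>i\<close> is invariance under the lattice they generate.
\<close>

definition periodic_on :: "'a::real_vector set \<Rightarrow> ('a \<Rightarrow> 'b) \<Rightarrow> bool"
  where "periodic_on V f \<longleftrightarrow>
    (\<exists>B \<subseteq> periods_on V f. finite B \<and> independent B \<and> card B = dim V)"

abbreviation periods :: "('a::real_vector \<Rightarrow> 'b) \<Rightarrow> 'a set"
  where "periods \<equiv> periods_on UNIV"

abbreviation periodic :: "('a::real_vector \<Rightarrow> 'b) \<Rightarrow> bool"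
  where "periodic \<equiv> periodic_on UNIV"

text \<open>
  \<open>q 0, \<dots>, q (N - 1)\<close> are the columns of the matrix \<open>K\<close>, so the argument of \<open>g\<close> is \<open>K\<^sup>T x\<close>.
\<close>

definition quasiperiodic :: "(real^'d \<Rightarrow> 'b) \<Rightarrow> bool"
  where "quasiperiodic f \<longleftrightarrow>
    \<not> periodic f \<and>
    (\<exists>N > CARD('d). \<exists>(g :: (nat \<Rightarrow> real) \<Rightarrow> 'b) (q :: nat \<Rightarrow> real^'d).
       periodic_on (coord_space N) g \<and>
       (\<forall>x. f x = g (\<lambda>j. if j < N then q j \<bullet> x else 0)))"


section \<open>Superpositions of plane waves\<close>

text \<open>
  An element \<open>u = [\<alpha>\<^sub>1, \<dots>, \<alpha>\<^sub>N, \<beta>\<^sub>1, \<dots>, \<beta>\<^sub>N]\<close> of \<open>\<complex>\<^bsup>2N\<^esup>\<close> is indexed by the sum type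
  \<^typ>\<open>'n + 'n\<close>: \<open>\<alpha>\<^sub>j = u $ Inl j\<close> and \<open>\<beta>\<^sub>j = u $ Inr j\<close>.
\<close>

definition p_N :: "complex^('n::finite + 'n) \<Rightarrow> real^'n \<Rightarrow> complex"
  where "p_N u y = (\<Sum>j\<in>UNIV.
      u $ Inl j * exp (\<i> * of_real (axis j 1 \<bullet> y)) +
      u $ Inr j * exp (- \<i> * of_real (axis j 1 \<bullet> y)))"

definition p_d :: "('n::finite \<Rightarrow> real^'d) \<Rightarrow> complex^('n + 'n) \<Rightarrow> real^'d \<Rightarrow> complex"
  where "p_d k u x = (\<Sum>j\<in>UNIV.
      u $ Inl j * exp (\<i> * of_real (k j \<bullet> x)) +
      u $ Inr j * exp (- \<i> * of_real (k j \<bullet> x)))"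

definition wave_matrix :: "('n::finite \<Rightarrow> real^'d) \<Rightarrow> real^'n^'d"
  where "wave_matrix k = (\<chi> i j. k j $ i)"

lemma p_d_eq_p_N: "p_d k u x = p_N u (transpose (wave_matrix k) *v x)"
proof -
  have "axis j 1 \<bullet> (transpose (wave_matrix k) *v x) = k j \<bullet> x" for j
    by (subst inner_axis')
      (simp add: wave_matrix_def transpose_def matrix_vector_mult_def inner_vec_def)
  then show ?thesis
    by (simp only: p_d_def p_N_def)
qed

definition two_pi_lattice :: "(real^'n) set"
  where "two_pi_lattice = {(2 * pi) *\<^sub>R n | n. \<forall>j. n $ j \<in> \<int>}"

text \<open>
  The part of \<open>p_d\<close> carried by the wavevectors \<open>v\<close> and \<open>-v\<close>. If \<open>k\<close> repeats a wavevector up to sign,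
  the amplitudes of the repeated waves can cancel, and then \<open>p_d\<close> no longer depends on that
  wavevector although \<open>p_N\<close> still depends on every coordinate.
\<close>

definition p_d_along :: "('n::finite \<Rightarrow> real^'d) \<Rightarrow> complex^('n + 'n) \<Rightarrow> real^'d \<Rightarrow> real^'d \<Rightarrow> complex"
  where "p_d_along k u v x = (\<Sum>j | k j = v \<or> k j = - v.
      u $ Inl j * exp (\<i> * of_real (k j \<bullet> x)) +
      u $ Inr j * exp (- \<i> * of_real (k j \<bullet> x)))"

definition no_cancellation :: "('n::finite \<Rightarrow> real^'d) \<Rightarrow> complex^('n + 'n) \<Rightarrow> bool"
  where "no_cancellation k u \<longleftrightarrow> (\<forall>j. \<exists>x. p_d_along k u (k j) x \<noteq> 0)"

text \<open>
  There is no cancellation when the \<open>2N\<close> vectors \<open>\<plusminus>k\<^sub>j\<close> are distinct.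
\<close>

lemma no_cancellation_if_distinct:
  fixes k :: "'n::finite \<Rightarrow> real^'d"
  assumes cell: "periods (p_N u) = two_pi_lattice"
    and nz: "\<And>j. k j \<noteq> 0"
    and distinct: "\<And>i j. i \<noteq> j \<Longrightarrow> k i \<noteq> k j \<and> k i \<noteq> - k j"
  shows "no_cancellation k u"
  unfolding no_cancellation_def
proof (intro allI, rule ccontr)
  fix j assume "\<nexists>x. p_d_along k u (k j) x \<noteq> 0"
  moreover have "{i. k i = k j \<or> k i = - k j} = {j}"
    using distinct by auto
  ultimately have zero: "u $ Inl j * exp (\<i> * of_real (k j \<bullet> x)) +
      u $ Inr j * exp (- \<i> * of_real (k j \<bullet> x)) = 0" for x
    by (simp add: p_d_along_def)
  define t where "t = (pi / 2 / (k j \<bullet> k j)) *\<^sub>R k j"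
  have t: "k j \<bullet> t = pi / 2"
    using nz[of j] by (simp add: t_def)
  have e: "exp (\<i> * of_real (pi / 2)) = \<i>" "exp (- \<i> * of_real (pi / 2)) = - \<i>"
    using cis_conv_exp[of "pi / 2"] by (simp_all only: cis_pi_half exp_minus mult_minus_left) simp
  have s: "u $ Inl j + u $ Inr j = 0"
    using zero[of 0] by simp
  have "u $ Inl j * \<i> - u $ Inr j * \<i> = 0"
    using zero[of t] unfolding t e by (simp add: algebra_simps)
  then have "(u $ Inl j - u $ Inr j) * \<i> = 0"
    by (simp add: algebra_simps)
  with s have ab: "u $ Inl j = 0" "u $ Inr j = 0"
    by auto
  have shift: "axis i 1 \<bullet> (x + axis j 1) = axis i 1 \<bullet> x" if "i \<noteq> j" for i and x :: "real^'n"
    using that by (simp add: inner_add_right inner_axis_axis)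
  have "p_N u (x + axis j 1) = p_N u x" for x
    unfolding p_N_def
  proof (rule sum.cong)
    fix i
    show "u $ Inl i * exp (\<i> * of_real (axis i 1 \<bullet> (x + axis j 1))) +
        u $ Inr i * exp (- \<i> * of_real (axis i 1 \<bullet> (x + axis j 1))) =
      u $ Inl i * exp (\<i> * of_real (axis i 1 \<bullet> x)) +
        u $ Inr i * exp (- \<i> * of_real (axis i 1 \<bullet> x))"
      by (cases "i = j") (simp_all only: shift ab mult_zero_left not_False_eq_True)
  qed simp
  then have "axis j 1 \<in> periods (p_N u)"
    by (simp add: periods_on_def)
  then obtain n :: "real^'n" where n: "axis j 1 = (2 * pi) *\<^sub>R n" "n $ j \<in> \<int>"
    unfolding cell two_pi_lattice_def by blast
  have "(axis j 1 :: real^'n) $ j = 1" by simp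
  then have 1: "2 * pi * n $ j = 1" using n(1) by simp
  obtain m where m: "n $ j = of_int m" using n(2) by (auto elim: Ints_cases)
  have "n $ j > 0" using 1 by (metis pi_gt_zero zero_less_mult_pos zero_less_numeral zero_less_one mult_pos_pos)
  then have "m > 0" using m by simp
  then have "n $ j \<ge> 1" using m by simp
  then have "2 * pi * n $ j \<ge> 2 * pi" by simp
  then show False using 1 pi_gt3 by linarith
qed

end

theory Submission
  imports Defs
begin

text \<open>
  Distinct characters \<open>x \<mapsto> exp (\<i> w \<bullet> x)\<close> are linearly independent, so \<open>a\<close> is a period of \<open>p\<^sub>d\<close> iff
  \<open>exp (\<i> w \<bullet> a) = 1\<close> for every wavevector \<open>w\<close> whose total amplitude is nonzero. In the absence of
  cancellation this says that \<open>K\<^sup>T a\<close> lies in the lattice \<open>(2\<pi>)\<int>\<^sup>N\<close>. As \<open>K\<^sup>T\<close> is injective, the periods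
  of \<open>p\<^sub>d\<close> span a space of the same dimension as \<open>range K\<^sup>T \<inter> (2\<pi>)\<int>\<^sup>N\<close>, and \<open>p\<^sub>d\<close> is periodic iff
  this dimension is \<open>d\<close>. The second condition of quasiperiodicity always holds: \<open>p\<^sub>N\<close> is a suitable
  periodic function, regarded as a function of \<open>N + 1 > d\<close> variables.
\<close>

section \<open>Trigonometric sums\<close>

lemma exp_i_eq_1_iff: "exp (\<i> * of_real t) = 1 \<longleftrightarrow> t / (2 * pi) \<in> \<int>"
proof -
  have "t = of_int (2 * n) * pi \<longleftrightarrow> t / (2 * pi) = of_int n" for n
    by (auto simp: field_simps)
  then show ?thesis
    by (auto simp: exp_eq_1 Ints_def)
qed

text \<open>The phase difference grows along \<open>v - w\<close>, so a suitable multiple of that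
  vector makes it exactly pi, and the two characters take opposite nonzero values there.\<close>

lemma exp_i_separates:
  fixes v w :: "'a::real_inner"
  assumes "v \<noteq> w"
  obtains y where "exp (\<i> * of_real (v \<bullet> y)) \<noteq> exp (\<i> * of_real (w \<bullet> y))"
proof
  define y where "y = (pi / ((v - w) \<bullet> (v - w))) *\<^sub>R (v - w)"
  have "v \<bullet> y = w \<bullet> y + pi"
    using assms inner_diff_left[of v w y] by (simp add: y_def)
  then have "exp (\<i> * of_real (v \<bullet> y)) = - exp (\<i> * of_real (w \<bullet> y))"
    by (simp add: distrib_left exp_add)
  then show "exp (\<i> * of_real (v \<bullet> y)) \<noteq> exp (\<i> * of_real (w \<bullet> y))"
    by simp
qed

text \<open>Artin's argument: translation by \<open>y\<close> multiplies each coefficient by the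
  value of its character at \<open>y\<close>, so a translate of the relation and a multiple of the
  original combine to a shorter relation.\<close>

lemma characters_independent:
  fixes W :: "'a::real_inner set" and c :: "'a \<Rightarrow> complex"
  assumes "finite W" and "\<And>x. (\<Sum>w\<in>W. c w * exp (\<i> * of_real (w \<bullet> x))) = 0" and "w \<in> W"
  shows "c w = 0"
  using assms
proof (induction W arbitrary: c w)
  case empty
  then show ?case by simp
next
  case (insert v W)
  let ?e = "\<lambda>w x. exp (\<i> * of_real (w \<bullet> x))"
  have sum0: "c v * ?e v x + (\<Sum>w\<in>W. c w * ?e w x) = 0" for x
    using insert.prems(1)[of x] insert.hyps by simp
  have W_sum: "(\<Sum>w\<in>W. c w * ?e w x) = - c v * ?e v x" for x
    using sum0[of x] by (simp add: eq_neg_iff_add_eq_0 add.commute)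
  have W0: "c w = 0" if w: "w \<in> W" for w
  proof -
    from w insert.hyps have "w \<noteq> v" by auto
    then obtain y where y: "?e w y \<noteq> ?e v y"
      using exp_i_separates by blast
    \<comment> \<open>The relation at \<open>x + y\<close> minus \<open>?e v y\<close> times the
      relation at \<open>x\<close>: the terms of \<open>v\<close> cancel, and the coefficient of the
      chosen \<open>w\<close> keeps a nonzero factor.\<close>
    have "(\<Sum>w\<in>W. (c w * (?e w y - ?e v y)) * ?e w x) = 0" for x
    proof -
      have "(\<Sum>w\<in>W. (c w * (?e w y - ?e v y)) * ?e w x)
          = (\<Sum>w\<in>W. c w * ?e w (x + y)) - ?e v y * (\<Sum>w\<in>W. c w * ?e w x)"
        by (simp add: sum_subtractf[symmetric] sum_distrib_left inner_add_right exp_add algebra_simps)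
      also have "\<dots> = (- c v * ?e v (x + y)) - ?e v y * (- c v * ?e v x)"
        by (simp only: W_sum)
      also have "\<dots> = 0"
        by (simp add: inner_add_right exp_add algebra_simps)
      finally show ?thesis .
    qed
    from insert.IH[OF this w] y show ?thesis by simp
  qed
  have "c v = 0"
    using sum0[of 0] W0 by simp
  with W0 insert.prems(2) show ?case by auto
qed

text \<open>Wavevectors may coincide, so independence of characters applies only after the
  amplitudes have been collected for each wavevector.\<close>

lemma sum_characters_group:
  fixes w :: "'s \<Rightarrow> 'a::real_inner" and c :: "'s \<Rightarrow> complex"
  assumes "finite S" "finite T" "w ` S \<subseteq> T"
  shows "(\<Sum>s\<in>S. c s * exp (\<i> * of_real (w s \<bullet> x)))
       = (\<Sum>v\<in>T. (\<Sum>s | s \<in> S \<and> w s = v. c s) * exp (\<i> * of_real (v \<bullet> x)))"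
proof -
  have "(\<Sum>s\<in>S. c s * exp (\<i> * of_real (w s \<bullet> x)))
      = (\<Sum>v\<in>T. \<Sum>s | s \<in> S \<and> w s = v. c s * exp (\<i> * of_real (w s \<bullet> x)))"
    using sum.group[OF assms, of "\<lambda>s. c s * exp (\<i> * of_real (w s \<bullet> x))"] by simp
  also have "\<dots> = (\<Sum>v\<in>T. (\<Sum>s | s \<in> S \<and> w s = v. c s) * exp (\<i> * of_real (v \<bullet> x)))"
    unfolding sum_distrib_right by (intro sum.cong refl) auto
  finally show ?thesis .
qed

text \<open>For a period \<open>a\<close>, the sum at \<open>x + a\<close> minus the sum at
  \<open>x\<close> is a vanishing character sum in which the total amplitude of each
  \<open>v\<close> is multiplied by \<open>exp (\<i> * of_real (v \<bullet> a)) - 1\<close>.\<close>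

lemma period_of_character_sum:
  fixes w :: "'s::finite \<Rightarrow> 'a::real_inner" and c :: "'s \<Rightarrow> complex"
  assumes "a \<in> periods (\<lambda>x. \<Sum>s\<in>UNIV. c s * exp (\<i> * of_real (w s \<bullet> x)))"
    and "(\<Sum>s | w s = v. c s) \<noteq> 0"
  shows "exp (\<i> * of_real (v \<bullet> a)) = 1"
proof -
  define C where "C v = (\<Sum>s | w s = v. c s)" for v
  have grp: "(\<Sum>s\<in>UNIV. c s * exp (\<i> * of_real (w s \<bullet> x)))
      = (\<Sum>v\<in>range w. C v * exp (\<i> * of_real (v \<bullet> x)))" for x
    using sum_characters_group[of UNIV "range w" w c x] by (simp add: C_def)
  have "(\<Sum>v\<in>range w. (C v * (exp (\<i> * of_real (v \<bullet> a)) - 1)) * exp (\<i> * of_real (v \<bullet> x))) = 0" for x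
  proof -
    have "(\<Sum>v\<in>range w. (C v * (exp (\<i> * of_real (v \<bullet> a)) - 1)) * exp (\<i> * of_real (v \<bullet> x)))
        = (\<Sum>v\<in>range w. C v * exp (\<i> * of_real (v \<bullet> (x + a))))
          - (\<Sum>v\<in>range w. C v * exp (\<i> * of_real (v \<bullet> x)))"
      by (simp add: sum_subtractf[symmetric] inner_add_right exp_add algebra_simps)
    also have "\<dots> = 0"
      using assms(1) unfolding periods_on_def grp by simp
    finally show ?thesis .
  qed
  then have "C v * (exp (\<i> * of_real (v \<bullet> a)) - 1) = 0" if "v \<in> range w" for v
    using characters_independent[of "range w" "\<lambda>v. C v * (exp (\<i> * of_real (v \<bullet> a)) - 1)" v] that by simp
  \<comment> \<open>Otherwise the total amplitude of \<open>v\<close> would be an empty sum.\<close>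
  moreover have "v \<in> range w"
    using assms(2) by (rule contrapos_np) (auto intro!: sum.neutral)
  ultimately show ?thesis
    using assms(2) by (auto simp: C_def)
qed

section \<open>Periods of the superpositions\<close>

text \<open>A conjugate wave is a plane wave with wavevector \<open>- k j\<close>, so both kinds
  merge into one character sum indexed by the sum type.\<close>

lemma plane_wave_sum_Plus:
  fixes u :: "complex^('n::finite + 'n)" and k :: "'n \<Rightarrow> real^'d"
  assumes "finite J"
  shows "(\<Sum>j\<in>J. u $ Inl j * exp (\<i> * of_real (k j \<bullet> x)) + u $ Inr j * exp (- \<i> * of_real (k j \<bullet> x)))
    = (\<Sum>s\<in>J <+> J. u $ s * exp (\<i> * of_real (case_sum k (\<lambda>j. - k j) s \<bullet> x)))"
  using assms by (simp add: sum.Plus sum.distrib)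

lemma transpose_wave_matrix_mult: "transpose (wave_matrix k) *v x = (\<chi> j. k j \<bullet> x)"
  by (simp add: vec_eq_iff wave_matrix_def transpose_def matrix_vector_mult_def inner_vec_def)

lemma periods_p_d:
  fixes k :: "'n::finite \<Rightarrow> real^'d"
  assumes "no_cancellation k u"
  shows "periods (p_d k u) = {a. transpose (wave_matrix k) *v a \<in> two_pi_lattice}"
proof -
  define w where "w = case_sum k (\<lambda>j. - k j)"
  have lattice: "transpose (wave_matrix k) *v a \<in> two_pi_lattice \<longleftrightarrow> (\<forall>j. (k j \<bullet> a) / (2 * pi) \<in> \<int>)"
    for a
  proof -
    show ?thesis
    proof
      assume "transpose (wave_matrix k) *v a \<in> two_pi_lattice"
      then obtain n where n: "transpose (wave_matrix k) *v a = (2 * pi) *\<^sub>R n" "\<forall>j. n $ j \<in> \<int>"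
        by (auto simp: two_pi_lattice_def)
      have "(k j \<bullet> a) / (2 * pi) = n $ j" for j
        using arg_cong[OF n(1), of "\<lambda>y. y $ j"] unfolding transpose_wave_matrix_mult by simp
      with n(2) show "\<forall>j. (k j \<bullet> a) / (2 * pi) \<in> \<int>" by simp
    next
      assume *: "\<forall>j. (k j \<bullet> a) / (2 * pi) \<in> \<int>"
      have "transpose (wave_matrix k) *v a = (2 * pi) *\<^sub>R (\<chi> j. (k j \<bullet> a) / (2 * pi))"
        unfolding transpose_wave_matrix_mult by (simp add: vec_eq_iff)
      with * show "transpose (wave_matrix k) *v a \<in> two_pi_lattice"
        unfolding two_pi_lattice_def by (auto intro!: exI)
    qed
  qed
  have p_d: "p_d k u = (\<lambda>x. \<Sum>s\<in>UNIV. u $ s * exp (\<i> * of_real (w s \<bullet> x)))"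
    using plane_wave_sum_Plus[of UNIV u k] by (simp add: p_d_def w_def fun_eq_iff)
  \<comment> \<open>Summing over the set \<open>{v, - v}\<close> counts the amplitudes once even if
    \<open>v = - v\<close>.\<close>
  have along: "p_d_along k u v x = (\<Sum>v'\<in>{v, - v}. (\<Sum>s | w s = v'. u $ s) * exp (\<i> * of_real (v' \<bullet> x)))"
    for v x
  proof -
    let ?J = "{j. k j = v \<or> k j = - v}"
    have neg: "- k j = v \<longleftrightarrow> k j = - v" for j
      by (metis minus_minus)
    have J: "?J <+> ?J = {s. w s = v \<or> w s = - v}"
    proof (rule set_eqI)
      fix s show "s \<in> ?J <+> ?J \<longleftrightarrow> s \<in> {s. w s = v \<or> w s = - v}"
        by (cases s) (simp_all add: w_def Plus_def image_iff neg disj_commute)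
    qed
    have sub: "{s. (w s = v \<or> w s = - v) \<and> w s = v'} = {s. w s = v'}" if "v' \<in> {v, - v}" for v'
      using that by auto
    have "p_d_along k u v x = (\<Sum>s | w s = v \<or> w s = - v. u $ s * exp (\<i> * of_real (w s \<bullet> x)))"
      unfolding p_d_along_def J[symmetric] unfolding w_def by (rule plane_wave_sum_Plus) simp
    also have "\<dots> = (\<Sum>v'\<in>{v, - v}. (\<Sum>s | s \<in> {s. w s = v \<or> w s = - v} \<and> w s = v'. u $ s)
        * exp (\<i> * of_real (v' \<bullet> x)))"
      by (rule sum_characters_group) auto
    also have "\<dots> = (\<Sum>v'\<in>{v, - v}. (\<Sum>s | w s = v'. u $ s) * exp (\<i> * of_real (v' \<bullet> x)))"
      by (intro sum.cong refl) (simp add: sub)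
    finally show ?thesis .
  qed
  show ?thesis
  proof (intro set_eqI iffI)
    fix a assume a: "a \<in> periods (p_d k u)"
    have "(k j \<bullet> a) / (2 * pi) \<in> \<int>" for j
    proof -
      obtain x where "p_d_along k u (k j) x \<noteq> 0"
        using assms by (auto simp: no_cancellation_def)
      \<comment> \<open>A nonvanishing sum has a nonzero term, so \<open>k j\<close> or
        \<open>- k j\<close> has nonzero total amplitude. Either one suffices, as the integers are
        closed under negation.\<close>
      then obtain v where v: "v \<in> {k j, - k j}" "(\<Sum>s | w s = v. u $ s) \<noteq> 0"
        unfolding along by (elim sum.not_neutral_contains_not_neutral) auto
      have "exp (\<i> * of_real (v \<bullet> a)) = 1"
        using period_of_character_sum[OF a[unfolded p_d] v(2)] .
      then have "(v \<bullet> a) / (2 * pi) \<in> \<int>"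
        by (simp only: exp_i_eq_1_iff)
      with v(1) show ?thesis by auto
    qed
    then show "a \<in> {a. transpose (wave_matrix k) *v a \<in> two_pi_lattice}"
      unfolding lattice by blast
  next
    fix a assume "a \<in> {a. transpose (wave_matrix k) *v a \<in> two_pi_lattice}"
    then have *: "(k j \<bullet> a) / (2 * pi) \<in> \<int>" for j
      unfolding lattice by blast
    have "(w s \<bullet> a) / (2 * pi) \<in> \<int>" for s
    proof (cases s)
      case (Inl j)
      with *[of j] show ?thesis by (simp add: w_def)
    next
      case (Inr j)
      with Ints_minus[OF *[of j]] show ?thesis by (simp add: w_def)
    qed
    then have "exp (\<i> * of_real (w s \<bullet> a)) = 1" for s
      by (simp only: exp_i_eq_1_iff)
    then have "p_d k u (x + a) = p_d k u x" for x
      by (simp add: p_d inner_add_right distrib_left exp_add)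
    then show "a \<in> periods (p_d k u)"
      by (simp add: periods_on_def)
  qed
qed

lemma two_pi_lattice_subset_periods_p_N:
  fixes u :: "complex^('n::finite + 'n)"
  shows "two_pi_lattice \<subseteq> periods (p_N u)"
proof
  fix a :: "real^'n" assume "a \<in> two_pi_lattice"
  then obtain n where n: "a = (2 * pi) *\<^sub>R n" "\<forall>j. n $ j \<in> \<int>"
    by (auto simp: two_pi_lattice_def)
  then have "exp (\<i> * of_real (axis j 1 \<bullet> a)) = 1" for j
    unfolding exp_i_eq_1_iff by (simp add: inner_axis')
  moreover from this have "exp (- \<i> * of_real (axis j 1 \<bullet> a)) = 1" for j
    by (simp add: exp_minus)
  ultimately have "p_N u (x + a) = p_N u x" for x
    by (simp only: p_N_def inner_add_right of_real_add distrib_left exp_add mult_1_right)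
  then show "a \<in> periods (p_N u)"
    by (simp add: periods_on_def)
qed

section \<open>Periodicity and quasiperiodicity\<close>

lemma periodic_iff_dim:
  fixes f :: "'a::euclidean_space \<Rightarrow> 'b"
  shows "periodic f \<longleftrightarrow> dim (periods f) = DIM('a)"
proof
  assume "periodic f"
  then obtain B where B: "B \<subseteq> periods f" "independent B" "card B = DIM('a)"
    by (auto simp: periodic_on_def)
  then have "DIM('a) \<le> dim (periods f)"
    using independent_card_le_dim by metis
  then show "dim (periods f) = DIM('a)"
    using dim_subset_UNIV[of "periods f"] by simp
next
  assume d: "dim (periods f) = DIM('a)"
  obtain B where "B \<subseteq> periods f" "independent B" "card B = dim (periods f)"
    by (rule basis_exists[of "periods f"])
  with d show "periodic f"
    by (auto simp: periodic_on_def independent_imp_finite)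
qed

text \<open>The \<open>N\<close> multiples of unit vectors by \<open>c\<close> are periods and span
  the whole space, so a basis can be selected among the periods.\<close>

lemma periodic_on_coord_space:
  fixes g :: "(nat \<Rightarrow> real) \<Rightarrow> 'b"
  assumes "N > 0" "c \<noteq> 0"
    and per: "\<And>j y. j < N \<Longrightarrow> y \<in> coord_space N \<Longrightarrow> g (y + (\<lambda>i. if i = j then c else 0)) = g y"
  shows "periodic_on (coord_space N) g"
proof -
  define b :: "nat \<Rightarrow> nat \<Rightarrow> real" where "b j = (\<lambda>i. if i = j then c else 0)" for j
  let ?P = "periods_on (coord_space N) g"
  have b: "b j \<in> ?P" if "j < N" for j
    using that per by (auto simp: periods_on_def b_def coord_space_def)
  have "span ?P = coord_space N"
  proof
    show "span ?P \<subseteq> coord_space N"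
      by (rule span_minimal[OF _ subspace_coord_space]) (auto simp: periods_on_def)
    show "coord_space N \<subseteq> span ?P"
    proof
      fix y assume "y \<in> coord_space N"
      moreover have "(\<Sum>j<N. (y j / c) *\<^sub>R b j) i = (if i < N then y i else 0)" for i
        using \<open>c \<noteq> 0\<close> by (simp add: sum_fun_apply scaleR_fun_def b_def if_distrib cong: if_cong)
      ultimately have "y = (\<Sum>j<N. (y j / c) *\<^sub>R b j)"
        by (auto simp: fun_eq_iff coord_space_def)
      also have "\<dots> \<in> span ?P"
        by (intro span_sum span_scale span_base) (simp add: b)
      finally show "y \<in> span ?P" .
    qed
  qed
  then have dim: "dim ?P = N"
    by (metis dim_span dim_coord_space)
  obtain B where B: "B \<subseteq> ?P" "independent B" "card B = dim ?P"
    by (rule basis_exists[of ?P])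
  \<comment> \<open>An infinite set has \<open>card\<close> equal to 0, which \<open>N > 0\<close>
    excludes.\<close>
  then have "finite B"
    using dim \<open>N > 0\<close> by (simp add: card_ge_0_finite)
  with B show ?thesis
    by (auto simp: periodic_on_def dim dim_coord_space)
qed

lemma quasiperiodic_p_d_iff:
  fixes k :: "'n::finite \<Rightarrow> real^'d::finite"
  assumes "CARD('d) \<le> CARD('n)"
  shows "quasiperiodic (p_d k u) \<longleftrightarrow> \<not> periodic (p_d k u)"
proof -
  let ?n = "CARD('n)"
  obtain h :: "nat \<Rightarrow> 'n" where h: "bij_betw h {0..<?n} UNIV"
    using ex_bij_betw_nat_finite[of "UNIV :: 'n set"] by auto
  define l where "l = inv_into {0..<?n} h"
  have l: "l i < ?n" "h (l i) = i" for i
    using h bij_betw_inv_into[OF h] bij_betw_inv_into_right[OF h] bij_betwE unfolding l_def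
    by fastforce+
  \<comment> \<open>Since \<open>l\<close> takes values below \<open>?n\<close>, \<open>g\<close> is
    constant in coordinate \<open>?n\<close>.\<close>
  define g :: "(nat \<Rightarrow> real) \<Rightarrow> complex" where "g y = p_N u (\<chi> i. y (l i))" for y
  define q where "q j = (if j < ?n then k (h j) else 0)" for j
  \<comment> \<open>The extra dimension secures strictly more than \<open>CARD('d)\<close> variables
    when \<open>CARD('d) = ?n\<close>. For \<open>j = ?n\<close> the vector \<open>a\<close> below
    is 0.\<close>
  have "periodic_on (coord_space (Suc ?n)) g"
  proof (rule periodic_on_coord_space[where c = "2 * pi"])
    fix j and y :: "nat \<Rightarrow> real"
    define a :: "real^'n" where "a = (\<chi> i. if l i = j then 2 * pi else 0)"
    have "a = (2 * pi) *\<^sub>R (\<chi> i. if l i = j then 1 else 0)"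
      by (simp add: a_def vec_eq_iff)
    then have "a \<in> two_pi_lattice"
      unfolding two_pi_lattice_def by (force intro!: exI)
    then have "p_N u ((\<chi> i. y (l i)) + a) = p_N u (\<chi> i. y (l i))"
      using two_pi_lattice_subset_periods_p_N[of u] by (auto simp: periods_on_def)
    moreover have "(\<chi> i. (y + (\<lambda>i. if i = j then 2 * pi else 0)) (l i)) = (\<chi> i. y (l i)) + a"
      by (simp add: a_def vec_eq_iff plus_fun_def)
    ultimately show "g (y + (\<lambda>i. if i = j then 2 * pi else 0)) = g y"
      by (simp add: g_def)
  qed auto
  moreover have "p_d k u x = g (\<lambda>j. if j < Suc ?n then q j \<bullet> x else 0)" for x
  proof -
    have "transpose (wave_matrix k) *v x = (\<chi> i. if l i < Suc ?n then q (l i) \<bullet> x else 0)"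
      unfolding transpose_wave_matrix_mult using l by (simp add: vec_eq_iff q_def less_Suc_eq)
    then show ?thesis
      by (simp only: p_d_eq_p_N g_def)
  qed
  moreover have "CARD('d) < Suc ?n"
    using assms by simp
  ultimately show ?thesis
    unfolding quasiperiodic_def by blast
qed

theorem lemma2p1:
  fixes k :: "'n::finite \<Rightarrow> real^'d::finite"
    and u :: "complex^('n + 'n)"
    and \<kappa> :: real
  assumes "CARD('d) \<le> CARD('n)"
    and "\<kappa> > 0"
    and "\<And>j. norm (k j) = \<kappa>"
    and "rank (wave_matrix k) = CARD('d)"
    and "periods (p_N u) = two_pi_lattice"
    and "no_cancellation k u"
  shows "quasiperiodic (p_d k u) \<longleftrightarrow>
    dim (range (\<lambda>x. transpose (wave_matrix k) *v x) \<inter> two_pi_lattice) \<le> CARD('d) - 1"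
proof -
  let ?K = "\<lambda>x. transpose (wave_matrix k) *v x"
  \<comment> \<open>Full row rank of the wave matrix is full column rank of its transpose.\<close>
  have "inj ?K"
    using assms(4) full_rank_injective[of "transpose (wave_matrix k)"] by (simp add: rank_transpose del: transpose_matrix_vector)
  moreover have "range ?K \<inter> two_pi_lattice = ?K ` periods (p_d k u)"
    unfolding periods_p_d[OF assms(6)] by auto
  ultimately have "dim (range ?K \<inter> two_pi_lattice) = dim (periods (p_d k u))"
    using dim_image_eq[OF matrix_vector_mul_linear inj_on_subset[OF _ subset_UNIV]] by metis
  moreover have "dim (periods (p_d k u)) \<le> CARD('d)"
    using dim_subset_UNIV[of "periods (p_d k u)"] by simp
  \<comment> \<open>With truncated subtraction, this makes the bound \<open>CARD('d) - 1\<close>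
    equivalent to strict inequality with \<open>CARD('d)\<close>.\<close>
  moreover have "CARD('d) > 0"
    by simp
  moreover have "periodic (p_d k u) \<longleftrightarrow> dim (periods (p_d k u)) = CARD('d)"
    by (simp add: periodic_iff_dim)
  ultimately show ?thesis
    unfolding quasiperiodic_p_d_iff[OF assms(1)] by linarith
qed

end
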